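(* For each integer $k \geq 0$, $\Delta(k)$ is a free subalgebra of $\widetilde{\Gamma}$; that is, $\Delta(k)$ is a subalgebra of $\widetilde{\Gamma}$ which is itself free as an associative $\mathbb{F}_2$-algebra.
   Context: Let $\mathbb{F}_2$ be the field with 2 elements. For $s \geq 1$ let $\widetilde{\Gamma}_{s,*} = \widetilde{H}_*(B(\mathbb{Z}/2)^{\wedge s}, \mathbb{F}_2)$ be the reduced homology of the $s$-fold smash product, and let $\widetilde{\Gamma}_{0,*} = H_*(\mathrm{pt}, \mathbb{F}_2) = \mathbb{F}_2$ (in degree 0). Let $\widetilde{\Gamma} = \{\widetilde{\Gamma}_{s,*}\}_{s \geq 0}$, bigraded by length $s$ and homological degree $d$. The natural maps $B(\mathbb{Z}/2)^{\wedge p} \times B(\mathbb{Z}/2)^{\wedge q} \to B(\mathbb{Z}/2)^{\wedge (p+q)}$ induce products $\widetilde{\Gamma}_{p,*} \otimes \widetilde{\Gamma}_{q,*} \to \widetilde{\Gamma}_{p+q,*}$, making $\widetilde{\Gamma}$ the free associative unital algebra $\mathbb{F}_2\langle \gamma_1, \gamma_2, \gamma_3, \ldots\rangle$, where $\gamma_k$ is the generator of $\widetilde{\Gamma}_{1,k} = \widetilde{H}_k(B(\mathbb{Z}/2))$ and has bidegree $(1,k)$. $\widetilde{\Gamma}$ is a right module over the mod 2 Steenrod algebra via the canonical action on homology (dual to the left action on cohomology). Explicitly, each $Sq^i$ ($i \geq 0$) acts linearly with $Sq^0 = \mathrm{id}$, $(\gamma_k)Sq^i = \binom{k-i}{i}\gamma_{k-i}$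 (interpreted as $0$ if $i \geq k$), $(1)Sq^i = 0$ for $i>0$, and the Cartan formula $(ab)Sq^n = \sum_{i+j=n} (a)Sq^i\,(b)Sq^j$ holds. For $k \geq 0$ and $s,d \geq 0$ define $\Delta(k)_{s,d} = \bigcap_{i=0}^{k} \ker\left(Sq^{2^i} : \widetilde{\Gamma}_{s,d} \to \widetilde{\Gamma}_{s,d-2^i}\right)$, and let $\Delta(k) = \{\Delta(k)_{s,d}\}_{s,d \geq 0}$. *)

theory Defs
  imports Complex_Main "HOL-Library.Poly_Mapping" "HOL-Library.Z2"
begin

section \<open>Free associative algebras over the field with two elements\<close>

text \<open>
  Words form a monoid under concatenation, written additively so that the convolution product of
  \<^type>\<open>poly_mapping\<close> is the product of the monoid algebra of a free monoid, i.e. of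
  noncommutative polynomials.
\<close>

instantiation list :: (type) monoid_add
begin
definition zero_list :: "'a list" where "zero_list = []"
definition plus_list :: "'a list \<Rightarrow> 'a list \<Rightarrow> 'a list" where "plus_list = (@)"
instance by standard (simp_all add: zero_list_def plus_list_def)
end

type_synonym 'a ncpoly = "'a list \<Rightarrow>\<^sub>0 bit"

definition scale :: "bit \<Rightarrow> 'a ncpoly \<Rightarrow> 'a ncpoly" where
  "scale c p = Poly_Mapping.map ((*) c) p"

lemma lookup_scale [simp]: "Poly_Mapping.lookup (scale c p) w = c * Poly_Mapping.lookup p w"
  by (simp add: scale_def Poly_Mapping.map.rep_eq when_def)

interpretation ncpoly: vector_space "scale :: bit \<Rightarrow> 'a ncpoly \<Rightarrow> 'a ncpoly"
  by standard (auto intro!: poly_mapping_eqI simp: lookup_add algebra_simps)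

definition free_alg :: "'a set \<Rightarrow> 'a ncpoly set" where
  "free_alg X = {p. \<forall>w\<in>Poly_Mapping.keys p. set w \<subseteq> X}"

definition subalgebra :: "'a ncpoly set \<Rightarrow> 'a ncpoly set \<Rightarrow> bool" where
  "subalgebra A B \<longleftrightarrow> A \<subseteq> B \<and> ncpoly.subspace A \<and> 1 \<in> A \<and> (\<forall>x\<in>A. \<forall>y\<in>A. x * y \<in> A)"

definition alg_iso :: "'a ncpoly set \<Rightarrow> 'b ncpoly set \<Rightarrow> ('a ncpoly \<Rightarrow> 'b ncpoly) \<Rightarrow> bool" where
  "alg_iso A B f \<longleftrightarrow> bij_betw f A B \<and> f 1 = 1 \<and>
     (\<forall>x\<in>A. \<forall>y\<in>A. f (x + y) = f x + f y \<and> f (x * y) = f x * f y) \<and>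
     (\<forall>c. \<forall>x\<in>A. f (scale c x) = scale c (f x))"

text \<open>
  It is no restriction to index the free generators by elements of the ambient algebra, since an
  isomorphism from a free algebra maps its generators injectively into \<open>A\<close>.
\<close>

definition is_free_algebra :: "'a ncpoly set \<Rightarrow> bool" where
  "is_free_algebra A \<longleftrightarrow> (\<exists>(X :: 'a ncpoly set) f. alg_iso (free_alg X) A f)"


section \<open>The bigraded algebra and the right action of the Steenrod squares\<close>

text \<open>
  The letter \<open>k \<ge> 1\<close> stands for the generator of bidegree \<open>(1, k)\<close>. The letter \<open>0\<close> of the
  ambient type does not occur in \<open>Gamma\<close>.
\<close>

definition gen :: "nat \<Rightarrow> nat ncpoly" where
  "gen k = Poly_Mapping.single [k] 1"

definition Gamma :: "nat ncpoly set" where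
  "Gamma = free_alg {1..}"

definition Gamma_comp :: "nat \<Rightarrow> nat \<Rightarrow> nat ncpoly set" where
  "Gamma_comp s d = {x \<in> Gamma. \<forall>w\<in>Poly_Mapping.keys x. length w = s \<and> sum_list w = d}"

definition Sq_gen :: "nat \<Rightarrow> nat \<Rightarrow> nat ncpoly" where
  "Sq_gen i k = (if i < k then scale (of_nat ((k - i) choose i)) (gen (k - i)) else 0)"

fun Sq_word :: "nat \<Rightarrow> nat list \<Rightarrow> nat ncpoly" where
  "Sq_word n [] = (if n = 0 then 1 else 0)"
| "Sq_word n (k # w) = (\<Sum>i\<le>n. Sq_gen i k * Sq_word (n - i) w)"

text \<open>\<open>Sq n x\<close> is the result of the right action of the \<open>n\<close>-th Steenrod square on \<open>x\<close>.\<close>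

definition Sq :: "nat \<Rightarrow> nat ncpoly \<Rightarrow> nat ncpoly" where
  "Sq n x = (\<Sum>w\<in>Poly_Mapping.keys x. scale (Poly_Mapping.lookup x w) (Sq_word n w))"

text \<open>
  The kernel of \<open>Sq (2 ^ i)\<close> on a component of degree less than \<open>2 ^ i\<close> is the whole
  component, in agreement with the vanishing of the target in negative degrees.
\<close>

definition Delta_comp :: "nat \<Rightarrow> nat \<Rightarrow> nat \<Rightarrow> nat ncpoly set" where
  "Delta_comp k s d = {x \<in> Gamma_comp s d. \<forall>i\<le>k. Sq (2 ^ i) x = 0}"

definition Delta :: "nat \<Rightarrow> nat ncpoly set" where
  "Delta k = ncpoly.span (\<Union>s d. Delta_comp k s d)"


section \<open>The action satisfies the rules that characterise it\<close>

lemma scale_mult_left: "scale c x * y = scale c (x * y)"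
  by (cases c) (simp_all add: ncpoly.scale_zero_left ncpoly.scale_one)

lemma scale_mult_right: "x * scale c y = scale c (x * y)"
  by (cases c) (simp_all add: ncpoly.scale_zero_left ncpoly.scale_one)

lemma Sq_superset:
  assumes "finite S" "Poly_Mapping.keys x \<subseteq> S"
  shows "Sq n x = (\<Sum>w\<in>S. scale (Poly_Mapping.lookup x w) (Sq_word n w))"
  unfolding Sq_def using assms
  by (intro sum.mono_neutral_left) (auto simp: in_keys_iff)

lemma Sq_add: "Sq n (x + y) = Sq n x + Sq n y"
proof -
  let ?S = "Poly_Mapping.keys x \<union> Poly_Mapping.keys y"
  have "Sq n (x + y) = (\<Sum>w\<in>?S. scale (Poly_Mapping.lookup (x + y) w) (Sq_word n w))"
    by (rule Sq_superset) (use keys_add[of x y] in auto)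
  also have "\<dots> = Sq n x + Sq n y"
    by (simp add: Sq_superset[of ?S] lookup_add ncpoly.scale_left_distrib sum.distrib
        del: add_bit_eq_xor)
  finally show ?thesis .
qed

lemma Sq_scale: "Sq n (scale c x) = scale c (Sq n x)"
  by (cases c) (simp_all add: Sq_def)

lemma Sq_zero [simp]: "Sq n 0 = 0"
  by (simp add: Sq_def)

lemma Sq_single: "Sq n (Poly_Mapping.single w c) = scale c (Sq_word n w)"
  by (cases c) (simp_all add: Sq_def)

lemma one_ncpoly: "(1 :: 'a ncpoly) = Poly_Mapping.single [] 1"
  by (simp add: zero_list_def flip: single_one)

lemma Sq_one: "Sq n 1 = (if n = 0 then 1 else 0)"
  by (simp add: one_ncpoly Sq_single)

lemma Sq_on_gen:
  "Sq i (gen k) = (if i < k then scale (of_nat ((k - i) choose i)) (gen (k - i)) else 0)"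
proof -
  have "Sq i (gen k) = (\<Sum>j\<le>i. if j = i then Sq_gen j k else 0)"
    unfolding gen_def Sq_single by (simp del: sum.delta sum.delta') (rule sum.cong; auto)
  then show ?thesis by (simp add: Sq_gen_def)
qed

lemma ncpoly_induct [case_names zero add]:
  assumes "P 0" "\<And>w x. P x \<Longrightarrow> P (Poly_Mapping.single w 1 + x)"
  shows "P (x :: 'a ncpoly)"
proof (induction x rule: update_induct)
  case const
  show ?case by (fact assms(1))
next
  case (update x w c)
  have "Poly_Mapping.update w c x = Poly_Mapping.single w 1 + x"
    using update by (intro poly_mapping_eqI)
      (auto simp: lookup_update lookup_add lookup_single when_def in_keys_iff)
  then show ?case using assms(2) update by simp
qed

lemma Sq_0:
  assumes "x \<in> Gamma"
  shows "Sq 0 x = x"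
proof -
  have *: "Sq_word 0 w = Poly_Mapping.single w 1" if "set w \<subseteq> {1..}" for w
    using that
    by (induction w) (auto simp: Sq_gen_def gen_def mult_single plus_list_def one_ncpoly)
  have "Sq 0 x = (\<Sum>w\<in>Poly_Mapping.keys x. Poly_Mapping.single w (Poly_Mapping.lookup x w))"
    unfolding Sq_def
  proof (rule sum.cong[OF refl])
    fix w assume "w \<in> Poly_Mapping.keys x"
    with assms * have "Sq_word 0 w = Poly_Mapping.single w 1"
      by (auto simp: Gamma_def free_alg_def)
    then show "scale (Poly_Mapping.lookup x w) (Sq_word 0 w)
        = Poly_Mapping.single w (Poly_Mapping.lookup x w)"
      by (cases "Poly_Mapping.lookup x w") simp_all
  qed
  also have "\<dots> = x"
    by (rule poly_mapping_eqI) (simp add: lookup_sum lookup_single when_def in_keys_iff)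
  finally show ?thesis .
qed

lemma Sq_word_append:
  "Sq_word n (u @ v) = (\<Sum>i\<le>n. Sq_word i u * Sq_word (n - i) v)"
proof (induction u arbitrary: n)
  case Nil
  have "(\<Sum>i\<le>n. Sq_word i [] * Sq_word (n - i) v) = (\<Sum>i\<le>n. if i = 0 then Sq_word n v else 0)"
    by (intro sum.cong) auto
  then show ?case by simp
next
  case (Cons k u)
  have "Sq_word n ((k # u) @ v)
      = (\<Sum>i\<le>n. \<Sum>j\<le>n - i. Sq_gen i k * (Sq_word j u * Sq_word (n - i - j) v))"
    by (simp add: Cons sum_distrib_left)
  also have "\<dots> = (\<Sum>m\<le>n. \<Sum>i\<le>m. Sq_gen i k * (Sq_word (m - i) u * Sq_word (n - m) v))"
    by (simp add: sum.Sigma)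
      (rule sum.reindex_bij_witness[where i = "\<lambda>(m, i). (i, m - i)" and j = "\<lambda>(i, j). (i + j, i)"];
        auto)
  also have "\<dots> = (\<Sum>m\<le>n. Sq_word m (k # u) * Sq_word (n - m) v)"
    by (simp add: sum_distrib_right mult.assoc)
  finally show ?case .
qed

lemma Sq_cartan: "Sq n (x * y) = (\<Sum>i\<le>n. Sq i x * Sq (n - i) y)"
proof (induction x rule: ncpoly_induct)
  case zero
  show ?case by simp
next
  case (add u x)
  have "Sq n (Poly_Mapping.single u 1 * y)
      = (\<Sum>i\<le>n. Sq i (Poly_Mapping.single u 1) * Sq (n - i) y)"
  proof (induction y rule: ncpoly_induct)
    case zero
    show ?case by simp
  next
    case (add v y)
    then show ?case
      by (simp add: distrib_left Sq_add mult_single plus_list_def Sq_single Sq_word_append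
          sum.distrib)
  qed
  with add show ?case by (simp add: distrib_right Sq_add sum.distrib)
qed

end

theory Submission
  imports Defs "HOL-Computational_Algebra.Polynomial"
begin

text \<open>
  Two facts make the theorem true: \<open>\<Delta>(k)\<close> is an algebra of invariants, and invariants of a
  length-preserving action on a free algebra inherit the weak algorithm of P. M. Cohn.

  \<^bold>\<open>Invariants.\<close> The squares \<open>Sq\<^sup>n\<close> with \<open>0 < n < 2^(k+1)\<close> all lie in the right ideal of the
  Steenrod algebra generated by the \<open>Sq^(2^i)\<close> with \<open>i \<le> k\<close>, so an element killed by the latter is
  killed by the former (\<open>Sq_eq_0_if_powers_eq_0\<close>). The Adem relations enter in the form of Bullett
  and Macdonald: put \<open>P(u) = \<Sum>\<^sub>n u\<^sup>n Sq\<^sup>n\<close>; then the composite of \<open>P(v)\<close> followed by \<open>P(u)\<close> depends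
  only on \<open>u + v\<close> and \<open>u v\<^sup>2\<close> (\<open>Bullett_Macdonald\<close>). By the Cartan formula this composite acts on words
  letter by letter, so the identity has to be checked on one letter only, where it is an identity
  between coefficients of a polynomial depending on \<open>u + v\<close> and \<open>u v\<^sup>2\<close>.
  Consequently \<open>Sq\<^sup>n (b f) = b Sq\<^sup>n f\<close> for \<open>b \<in> \<Delta>(k)\<close>, arbitrary \<open>f\<close> and \<open>0 < n < 2^(k+1)\<close>, which gives
  closure under products at once.

  \<^bold>\<open>Freeness.\<close> Let \<open>F\<close> be the ambient free algebra. Take a set \<open>X\<close> of elements of \<open>\<Delta>(k)\<close>, each
  homogeneous of positive length, that is a basis of the positive part modulo products of two
  elements of positive length. It generates \<open>\<Delta>(k)\<close>, by induction on length. If \<open>X\<close> were right linearly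
  dependent over \<open>F\<close>, a minimal dependence would, by the weak algorithm
  (\<open>right_dependent_homogeneous\<close>), express some \<open>t \<in> X\<close> as \<open>\<Sum> s g\<^sub>s\<close> over right independent other
  elements \<open>s\<close> of \<open>X\<close>. Applying \<open>Sq\<^sup>n\<close> gives \<open>0 = \<Sum> s Sq\<^sup>n g\<^sub>s\<close>, hence \<open>Sq\<^sup>n g\<^sub>s = 0\<close>; so the \<open>g\<^sub>s\<close> are
  in \<open>\<Delta>(k)\<close> and \<open>t\<close> is redundant, a contradiction. Finally, right independence of \<open>X\<close> over \<open>F\<close>
  excludes relations between the elements of \<open>X\<close>, since a relation of minimal degree can be
  shortened by its first letters (\<open>eval_words_kernel\<close>). The argument is isolated in
  \<open>free_if_right_saturated\<close>.
\<close>

section \<open>Noncommutative polynomials over the field with two elements\<close>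

text \<open>
  These rewrite rules would hide the ring structure of \<^typ>\<open>bit\<close> behind bit operations.
\<close>

declare add_bit_eq_xor [simp del] mult_bit_eq_and [simp del]

lemma bit_add_self [simp]: "b + b = (0 :: bit)"
  by (cases b) simp_all

abbreviation word :: "'a list \<Rightarrow> 'a ncpoly" where
  "word w \<equiv> Poly_Mapping.single w 1"

lemma ncpoly_add_self [simp]: "x + x = (0 :: 'a ncpoly)"
  by (rule poly_mapping_eqI) (simp add: lookup_add)

lemma ncpoly_uminus [simp]: "- x = (x :: 'a ncpoly)"
  by (rule poly_mapping_eqI) simp

lemma word_mult: "word u * word v = word (u @ v)"
  by (simp add: mult_single plus_list_def)

lemma keys_mult_words:
  "w \<in> Poly_Mapping.keys (x * y) \<Longrightarrow>
    \<exists>u\<in>Poly_Mapping.keys x. \<exists>v\<in>Poly_Mapping.keys y. w = u @ v" for x :: "'a ncpoly"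
  using keys_mult[of x y] unfolding plus_list_def by blast

lemma lookup_letter_mult:
  "Poly_Mapping.lookup (word [a] * q) w
    = (case w of [] \<Rightarrow> 0 | b # u \<Rightarrow> if b = a then Poly_Mapping.lookup q u else 0)"
proof (induction q rule: ncpoly_induct)
  case zero
  show ?case by (simp split: list.split)
next
  case (add v x)
  then show ?case
    by (auto simp: distrib_left word_mult lookup_add lookup_single when_def split: list.split)
qed

lemma ncpoly_eq_sum_words: "x = (\<Sum>w\<in>Poly_Mapping.keys x. word w)"
  by (rule poly_mapping_eqI) (auto simp: lookup_sum lookup_single when_def in_keys_iff)

definition restrict_words :: "('a list \<Rightarrow> bool) \<Rightarrow> 'a ncpoly \<Rightarrow> 'a ncpoly" where
  "restrict_words P x = (\<Sum>w | w \<in> Poly_Mapping.keys x \<and> P w. word w)"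

lemma lookup_restrict_words [simp]:
  "Poly_Mapping.lookup (restrict_words P x) w = (if P w then Poly_Mapping.lookup x w else 0)"
  by (simp add: restrict_words_def lookup_sum lookup_single when_def) (simp add: in_keys_iff)

lemma keys_restrict_words: "Poly_Mapping.keys (restrict_words P x) = {w\<in>Poly_Mapping.keys x. P w}"
  by (auto simp: in_keys_iff split: if_splits)

lemma restrict_words_zero [simp]: "restrict_words P 0 = 0"
  by (rule poly_mapping_eqI) simp

lemma restrict_words_add: "restrict_words P (x + y) = restrict_words P x + restrict_words P y"
  by (rule poly_mapping_eqI) (simp add: lookup_add)

lemma restrict_words_scale: "restrict_words P (scale c x) = scale c (restrict_words P x)"
  by (rule poly_mapping_eqI) simp

lemma restrict_words_sum: "restrict_words P (\<Sum>i\<in>I. f i) = (\<Sum>i\<in>I. restrict_words P (f i))"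
  by (rule poly_mapping_eqI) (simp add: lookup_sum)

lemma restrict_words_id: "(\<forall>w\<in>Poly_Mapping.keys x. P w) \<Longrightarrow> restrict_words P x = x"
  by (rule poly_mapping_eqI) (auto simp: in_keys_iff)

lemma restrict_words_none: "(\<forall>w\<in>Poly_Mapping.keys x. \<not> P w) \<Longrightarrow> restrict_words P x = 0"
  by (rule poly_mapping_eqI) (auto simp: in_keys_iff)

section \<open>The grading by length\<close>

definition homog :: "nat \<Rightarrow> 'a ncpoly \<Rightarrow> bool" where
  "homog n x \<longleftrightarrow> (\<forall>w\<in>Poly_Mapping.keys x. length w = n)"

abbreviation homog_part :: "nat \<Rightarrow> 'a ncpoly \<Rightarrow> 'a ncpoly" where
  "homog_part n \<equiv> restrict_words (\<lambda>w. length w = n)"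

lemma homog_homog_part: "homog n (homog_part n x)"
  by (auto simp: homog_def keys_restrict_words)

lemma homog_part_homog: "homog m x \<Longrightarrow> homog_part n x = (if m = n then x else 0)"
  by (auto simp: homog_def intro: restrict_words_id restrict_words_none)

lemma homog_mult: "homog m x \<Longrightarrow> homog n y \<Longrightarrow> homog (m + n) (x * y)"
  by (force simp: homog_def dest: keys_mult_words)

lemma homog_unique: "homog m x \<Longrightarrow> homog n x \<Longrightarrow> x \<noteq> 0 \<Longrightarrow> m = n"
  by (metis homog_part_homog)

lemma homog_0: "homog 0 x \<Longrightarrow> x = scale (Poly_Mapping.lookup x []) 1"
  by (rule poly_mapping_eqI)
    (auto simp: homog_def one_ncpoly lookup_single when_def not_in_keys_iff_lookup_eq_zero[symmetric])

lemma homog_part_mult: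
  assumes "homog s a"
  shows "homog_part (s + n) (a * f) = a * homog_part n f"
proof (induction f rule: ncpoly_induct)
  case zero
  show ?case by simp
next
  case (add v x)
  have "homog (length v) (word v)" by (simp add: homog_def)
  with assms have "homog_part (s + n) (a * word v) = a * homog_part n (word v)"
    using homog_part_homog[OF homog_mult[of s a "length v" "word v"]] homog_part_homog[of "length v" "word v" n]
    by auto
  with add show ?case by (simp add: distrib_left restrict_words_add)
qed

lemma homog_part_mult_less:
  assumes "homog s a" "n < s"
  shows "homog_part n (a * f) = 0"
  using assms by (intro restrict_words_none) (force simp: homog_def dest: keys_mult_words)

lemma ncpoly_eq_sum_homog_part: "x = (\<Sum>n\<in>length ` Poly_Mapping.keys x. homog_part n x)"
  by (rule poly_mapping_eqI) (auto simp: lookup_sum in_keys_iff)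

lemma subspace_free_alg: "ncpoly.subspace (free_alg X)"
proof (rule ncpoly.subspaceI)
  show "x + y \<in> free_alg X" if "x \<in> free_alg X" "y \<in> free_alg X" for x y
    using that keys_add[of x y] by (auto simp: free_alg_def)
  show "scale c x \<in> free_alg X" if "x \<in> free_alg X" for c x
    using that by (cases c) (auto simp: free_alg_def)
qed (simp add: free_alg_def)

lemma free_alg_mult: "x \<in> free_alg X \<Longrightarrow> y \<in> free_alg X \<Longrightarrow> x * y \<in> free_alg X"
  by (force simp: free_alg_def dest!: keys_mult_words)

lemma one_in_free_alg: "1 \<in> free_alg X"
  by (simp add: free_alg_def one_ncpoly)

lemma free_alg_restrict_words: "x \<in> free_alg X \<Longrightarrow> restrict_words P x \<in> free_alg X"
  by (auto simp: free_alg_def keys_restrict_words)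

section \<open>The weak algorithm\<close>

text \<open>
  The right transduction by \<open>w\<close>: if \<open>x = \<Sum> x\<^sub>v v\<close> with \<open>v\<close> ranging over the words of the same length
  as \<open>w\<close>, up to terms that are too short, then \<open>strip_suffix w x\<close> is the coefficient \<open>x\<^sub>w\<close>.
\<close>

definition strip_suffix :: "'a list \<Rightarrow> 'a ncpoly \<Rightarrow> 'a ncpoly" where
  "strip_suffix w = Poly_Mapping.map_key (\<lambda>u. u @ w)"

lemma lookup_strip_suffix [simp]:
  "Poly_Mapping.lookup (strip_suffix w x) u = Poly_Mapping.lookup x (u @ w)"
  by (simp add: strip_suffix_def map_key.rep_eq inj_def)

lemma keys_strip_suffix: "Poly_Mapping.keys (strip_suffix w x) = {u. u @ w \<in> Poly_Mapping.keys x}"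
  by (auto simp: in_keys_iff)

lemma strip_suffix_zero [simp]: "strip_suffix w 0 = 0"
  by (rule poly_mapping_eqI) simp

lemma strip_suffix_add: "strip_suffix w (x + y) = strip_suffix w x + strip_suffix w y"
  by (rule poly_mapping_eqI) (simp add: lookup_add)

lemma strip_suffix_sum: "strip_suffix w (\<Sum>i\<in>I. f i) = (\<Sum>i\<in>I. strip_suffix w (f i))"
  by (rule poly_mapping_eqI) (simp add: lookup_sum)

lemma free_alg_strip_suffix: "x \<in> free_alg X \<Longrightarrow> strip_suffix w x \<in> free_alg X"
  by (fastforce simp: free_alg_def keys_strip_suffix)

lemma homog_strip_suffix: "homog n x \<Longrightarrow> homog (n - length w) (strip_suffix w x)"
  by (fastforce simp: homog_def keys_strip_suffix)

lemma strip_suffix_mult_word: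
  assumes "length w' = length w"
  shows "strip_suffix w (b * word w') = (if w' = w then b else 0)"
proof (induction b rule: ncpoly_induct)
  case zero
  show ?case by simp
next
  case (add u x)
  have "strip_suffix w (word (u @ w')) = (if w' = w then word u else 0)"
    using assms by (intro poly_mapping_eqI) (auto simp: lookup_single when_def)
  with add show ?case by (simp add: distrib_right word_mult strip_suffix_add)
qed

text \<open>
  Transduction is linear over left multiplication as long as the suffix is taken from the right
  factor alone; this is what lets it act on the coefficients of a right linear relation.
\<close>

lemma strip_suffix_mult:
  assumes "\<forall>v\<in>Poly_Mapping.keys f. length w \<le> length v"
  shows "strip_suffix w (a * f) = a * strip_suffix w f"
proof -
  have *: "strip_suffix w (a * word v) = a * strip_suffix w (word v)"
    if "length w \<le> length v" for v
  proof -
    define u w' where "u = take (length v - length w) v" and "w' = drop (length v - length w) v"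
    have v: "v = u @ w'" "length w' = length w" using that by (simp_all add: u_def w'_def)
    show ?thesis
      using strip_suffix_mult_word[OF v(2), of "a * word u"] strip_suffix_mult_word[OF v(2), of "word u"]
      by (simp add: v(1) word_mult mult.assoc)
  qed
  have "strip_suffix w (a * f) = (\<Sum>v\<in>Poly_Mapping.keys f. strip_suffix w (a * word v))"
    by (subst ncpoly_eq_sum_words[of f]) (simp add: sum_distrib_left strip_suffix_sum)
  also have "\<dots> = (\<Sum>v\<in>Poly_Mapping.keys f. a * strip_suffix w (word v))"
    using * assms by (intro sum.cong) auto
  also have "\<dots> = a * strip_suffix w f"
    by (subst (2) ncpoly_eq_sum_words[of f]) (simp add: sum_distrib_left strip_suffix_sum)
  finally show ?thesis .
qed

text \<open>
  The coefficients come from \<open>F\<close> and stand on the right. The notion is meant for finite \<open>S\<close>, as the sum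
  over an infinite set is zero by convention.
\<close>

definition right_indep :: "'a ncpoly set \<Rightarrow> 'a ncpoly set \<Rightarrow> bool" where
  "right_indep F S \<longleftrightarrow>
     (\<forall>g. (\<forall>s\<in>S. g s \<in> F) \<longrightarrow> (\<Sum>s\<in>S. s * g s) = 0 \<longrightarrow> (\<forall>s\<in>S. g s = 0))"

text \<open>
  This is the weak algorithm of the free algebra. Among the nonzero coefficients of a homogeneous
  relation choose one, say that of \<open>t\<close>, of least length, and one of its words \<open>w\<close>. All nonzero
  coefficients have words at least as long as \<open>w\<close>, so stripping \<open>w\<close> yields another relation, in which
  the coefficient of \<open>t\<close> is a nonzero scalar.
\<close>

lemma right_dependent_homogeneous:
  assumes fin: "finite S" and dep: "\<not> right_indep (free_alg Y) S"
    and hom: "\<And>s. s \<in> S \<Longrightarrow> homog (len s) s"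
  obtains t g where "t \<in> S" "\<And>s. s \<in> S \<Longrightarrow> g s \<in> free_alg Y"
    "\<And>s. s \<in> S \<Longrightarrow> \<exists>n. homog n (g s)" "t = (\<Sum>s\<in>S - {t}. s * g s)"
proof -
  from dep obtain f r where f: "\<And>s. s \<in> S \<Longrightarrow> f s \<in> free_alg Y" "(\<Sum>s\<in>S. s * f s) = 0"
    and r: "r \<in> S" "f r \<noteq> 0" unfolding right_indep_def by auto
  from r obtain v where v: "v \<in> Poly_Mapping.keys (f r)"
    by fastforce
  \<comment> \<open>Only the part of the relation in a single total length, one where \<open>r\<close> contributes, is kept.\<close>
  define D where "D = len r + length v"
  define h where "h s = (if len s \<le> D then homog_part (D - len s) (f s) else 0)" for s
  have h: "s * h s = homog_part D (s * f s)" if "s \<in> S" for s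
    using homog_part_mult[OF hom[OF that], of "D - len s" "f s"]
      homog_part_mult_less[OF hom[OF that], of D "f s"]
    by (auto simp: h_def)
  have hY: "h s \<in> free_alg Y" if "s \<in> S" for s
    using f(1)[OF that] by (auto simp: h_def free_alg_restrict_words) (simp add: free_alg_def)
  have h0: "(\<Sum>s\<in>S. s * h s) = 0"
    using f(2) by (simp add: h flip: restrict_words_sum)
  have hh: "homog (D - len s) (h s)" for s
    by (simp add: h_def homog_homog_part) (simp add: homog_def)
  have "h r \<noteq> 0"
    using v keys_restrict_words[of "\<lambda>w. length w = length v" "f r"] by (auto simp: h_def D_def)
  then have "\<exists>t. (t \<in> S \<and> h t \<noteq> 0) \<and> (\<forall>s. s \<in> S \<and> h s \<noteq> 0 \<longrightarrow> D - len t \<le> D - len s)"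
    using r by (intro ex_has_least_nat) auto
  then obtain t where t: "t \<in> S" "h t \<noteq> 0"
    and min: "\<And>s. s \<in> S \<Longrightarrow> h s \<noteq> 0 \<Longrightarrow> D - len t \<le> D - len s" by blast
  from t obtain w where w: "w \<in> Poly_Mapping.keys (h t)"
    by fastforce
  have lw: "length w = D - len t" using w hh[of t] by (auto simp: homog_def)
  define g where "g s = strip_suffix w (h s)" for s
  have strip: "strip_suffix w (s * h s) = s * g s" if "s \<in> S" for s
    unfolding g_def
  proof (rule strip_suffix_mult, rule ballI)
    fix u assume u: "u \<in> Poly_Mapping.keys (h s)"
    then have "h s \<noteq> 0" by auto
    with u hh[of s] min[OF that] lw show "length w \<le> length u" by (auto simp: homog_def)
  qed
  have "(\<Sum>s\<in>S. s * g s) = strip_suffix w (\<Sum>s\<in>S. s * h s)"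
    by (simp add: strip_suffix_sum strip)
  then have sum0: "(\<Sum>s\<in>S. s * g s) = 0" by (simp add: h0)
  have "homog 0 (g t)"
    using homog_strip_suffix[OF hh, of t w] lw by (simp add: g_def)
  from homog_0[OF this] have "g t = scale (Poly_Mapping.lookup (h t) w) 1"
    by (simp add: g_def)
  also have "Poly_Mapping.lookup (h t) w = 1" using w by (simp add: in_keys_iff)
  finally have "g t = 1" by simp
  with sum0 have "t + (\<Sum>s\<in>S - {t}. s * g s) = 0"
    using sum.remove[OF fin t(1), of "\<lambda>s. s * g s"] by simp
  then have "t = (\<Sum>s\<in>S - {t}. s * g s)"
    using eq_neg_iff_add_eq_0 ncpoly_uminus by metis
  with t(1) show ?thesis
    by (intro that[of t g]) (auto simp: g_def hY free_alg_strip_suffix intro: homog_strip_suffix hh)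
qed

section \<open>The subalgebra generated by a right independent set\<close>

text \<open>
  Coefficients do not appear in the sum because the only nonzero scalar is \<open>1\<close>.
\<close>

definition eval_words :: "'a ncpoly ncpoly \<Rightarrow> 'a ncpoly" where
  "eval_words p = (\<Sum>w\<in>Poly_Mapping.keys p. prod_list w)"

lemma eval_words_superset:
  assumes "finite S" "Poly_Mapping.keys p \<subseteq> S"
  shows "eval_words p = (\<Sum>w\<in>S. scale (Poly_Mapping.lookup p w) (prod_list w))"
proof -
  have "eval_words p = (\<Sum>w\<in>Poly_Mapping.keys p. scale (Poly_Mapping.lookup p w) (prod_list w))"
    unfolding eval_words_def by (intro sum.cong) (auto simp: in_keys_iff)
  also have "\<dots> = (\<Sum>w\<in>S. scale (Poly_Mapping.lookup p w) (prod_list w))"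
    using assms by (intro sum.mono_neutral_left) (auto simp: in_keys_iff)
  finally show ?thesis .
qed

lemma eval_words_zero [simp]: "eval_words 0 = 0"
  by (simp add: eval_words_def)

lemma eval_words_word [simp]: "eval_words (word w) = prod_list w"
  by (simp add: eval_words_def)

lemma eval_words_one [simp]: "eval_words 1 = 1"
  by (simp add: one_ncpoly)

lemma eval_words_scale: "eval_words (scale c p) = scale c (eval_words p)"
  by (cases c) simp_all

lemma eval_words_add: "eval_words (p + q) = eval_words p + eval_words q"
proof -
  let ?S = "Poly_Mapping.keys p \<union> Poly_Mapping.keys q"
  have "eval_words (p + q) = (\<Sum>w\<in>?S. scale (Poly_Mapping.lookup (p + q) w) (prod_list w))"
    by (rule eval_words_superset) (use keys_add[of p q] in auto)
  also have "\<dots> = eval_words p + eval_words q"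
    by (simp add: eval_words_superset[of ?S] lookup_add ncpoly.scale_left_distrib sum.distrib)
  finally show ?thesis .
qed

lemma eval_words_sum: "eval_words (\<Sum>i\<in>I. f i) = (\<Sum>i\<in>I. eval_words (f i))"
  by (induction I rule: infinite_finite_induct) (simp_all add: eval_words_add)

lemma eval_words_mult: "eval_words (p * q) = eval_words p * eval_words q"
proof (induction p rule: ncpoly_induct)
  case zero
  show ?case by simp
next
  case (add u p)
  have "eval_words (word u * q) = prod_list u * eval_words q"
    by (induction q rule: ncpoly_induct)
      (simp_all add: distrib_left eval_words_add word_mult)
  with add show ?case by (simp add: distrib_right eval_words_add)
qed

lemma eval_words_in:
  assumes "subalgebra B C" "X \<subseteq> B" "p \<in> free_alg X"
  shows "eval_words p \<in> B"
proof -
  have "prod_list w \<in> B" if "set w \<subseteq> X" for w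
    using that assms(1,2) by (induction w) (auto simp: subalgebra_def)
  then show ?thesis
    using assms unfolding eval_words_def
    by (intro ncpoly.subspace_sum) (auto simp: subalgebra_def free_alg_def)
qed

text \<open>
  Split a relation by first letters: \<open>p = c + \<Sum> x L\<^sub>x\<close>. Its value has constant term \<open>c\<close>, so \<open>c = 0\<close>, and
  right independence makes each \<open>L\<^sub>x\<close> a relation, of smaller degree.
\<close>

lemma eval_words_kernel:
  assumes indep: "\<And>S. finite S \<Longrightarrow> S \<subseteq> X \<Longrightarrow> right_indep (free_alg Y) S"
    and X: "X \<subseteq> free_alg Y" "\<And>x. x \<in> X \<Longrightarrow> Poly_Mapping.lookup x [] = 0"
    and p: "p \<in> free_alg X" "eval_words p = 0"
  shows "p = 0"
proof -
  have Ysub: "subalgebra (free_alg Y) (free_alg Y)"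
    by (simp add: subalgebra_def subspace_free_alg one_in_free_alg free_alg_mult)
  have "p = 0" if "\<forall>w\<in>Poly_Mapping.keys p. length w < n" "p \<in> free_alg X" "eval_words p = 0" for n p
    using that
  proof (induction n arbitrary: p)
    case 0
    then show ?case by simp
  next
    case (Suc n)
    define L where "L x = Poly_Mapping.map_key ((#) x) p" for x
    have lookup_L: "Poly_Mapping.lookup (L x) w = Poly_Mapping.lookup p (x # w)" for x w
      by (simp add: L_def map_key.rep_eq inj_def)
    have keys_L: "Poly_Mapping.keys (L x) = {w. x # w \<in> Poly_Mapping.keys p}" for x
      by (auto simp: in_keys_iff lookup_L)
    define S where "S = hd ` (Poly_Mapping.keys p - {[]})"
    have "hd w \<in> X" if "w \<in> Poly_Mapping.keys p" "w \<noteq> []" for w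
    proof -
      have "set w \<subseteq> X" using Suc.prems(2) that(1) by (auto simp: free_alg_def)
      with hd_in_set[OF that(2)] show ?thesis by blast
    qed
    then have S: "finite S" "S \<subseteq> X" by (auto simp: S_def)
    have Lsmall: "length w < n" if "w \<in> Poly_Mapping.keys (L x)" for w x
      using that Suc.prems(1) by (fastforce simp: keys_L)
    have LX: "L x \<in> free_alg X" for x
      using Suc.prems(2) by (fastforce simp: keys_L free_alg_def)
    define c where "c = Poly_Mapping.lookup p []"
    have split: "p = scale c 1 + (\<Sum>x\<in>S. word [x] * L x)"
    proof (rule poly_mapping_eqI)
      fix w
      show "Poly_Mapping.lookup p w = Poly_Mapping.lookup (scale c 1 + (\<Sum>x\<in>S. word [x] * L x)) w"
      proof (cases w)
        case Nil
        then show ?thesis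
          by (simp add: lookup_add lookup_sum lookup_letter_mult c_def one_ncpoly)
      next
        case (Cons y u)
        have "Poly_Mapping.lookup p (y # u) = 0" if "y \<notin> S"
          using that by (force simp: S_def in_keys_iff image_iff)
        then show ?thesis using S(1)
          by (simp add: lookup_add lookup_sum lookup_letter_mult one_ncpoly lookup_single
              lookup_L Cons)
      qed
    qed
    have ev: "0 = scale c 1 + (\<Sum>x\<in>S. x * eval_words (L x))"
      using Suc.prems(3) by (subst (asm) split)
        (simp add: eval_words_add eval_words_scale eval_words_sum eval_words_mult)
    have "Poly_Mapping.lookup (x * y) [] = 0" if "x \<in> S" for x y
    proof (rule ccontr)
      assume "Poly_Mapping.lookup (x * y) [] \<noteq> 0"
      then have "[] \<in> Poly_Mapping.keys (x * y)" by (simp add: in_keys_iff)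
      then have "[] \<in> Poly_Mapping.keys x" by (auto dest: keys_mult_words)
      with X(2)[of x] that S(2) show False by (auto simp: in_keys_iff)
    qed
    with arg_cong[OF ev, of "\<lambda>z. Poly_Mapping.lookup z []"] have "c = 0"
      by (simp add: lookup_add lookup_sum one_ncpoly)
    with ev have "(\<Sum>x\<in>S. x * eval_words (L x)) = 0" by simp
    moreover have "eval_words (L x) \<in> free_alg Y" for x
      using eval_words_in[OF Ysub X(1) LX] .
    ultimately have "eval_words (L x) = 0" if "x \<in> S" for x
      using indep[OF S, unfolded right_indep_def, rule_format, of "\<lambda>x. eval_words (L x)"] that
      by blast
    then have "L x = 0" if "x \<in> S" for x
      using Suc.IH[of "L x"] Lsmall LX that by blast
    then show ?case using split \<open>c = 0\<close> by simp
  qed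
  from this[of p "Suc (Max (length ` Poly_Mapping.keys p))"] p show ?thesis
    by (auto simp: less_Suc_eq_le)
qed

section \<open>A criterion for freeness\<close>

text \<open>
  The assumption \<open>sat\<close> says that \<open>B\<close> is saturated: coefficients with respect to right independent
  elements of \<open>B\<close> are in \<open>B\<close> as soon as the linear combination is. It transfers the weak algorithm
  from the free algebra to \<open>B\<close>.
\<close>

theorem free_if_right_saturated:
  assumes B: "subalgebra B (free_alg Y)"
    and graded: "\<And>x n. x \<in> B \<Longrightarrow> homog_part n x \<in> B"
    and sat: "\<And>S g. finite S \<Longrightarrow> S \<subseteq> B \<Longrightarrow> right_indep (free_alg Y) S \<Longrightarrow>
      (\<And>s. s \<in> S \<Longrightarrow> g s \<in> free_alg Y) \<Longrightarrow> (\<Sum>s\<in>S. s * g s) \<in> B \<Longrightarrow> \<forall>s\<in>S. g s \<in> B"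
  shows "is_free_algebra B"
proof -
  have BY: "B \<subseteq> free_alg Y" and Bsub: "ncpoly.subspace B" and B1: "1 \<in> B"
    and Bmult: "\<And>x y. x \<in> B \<Longrightarrow> y \<in> B \<Longrightarrow> x * y \<in> B"
    using B by (auto simp: subalgebra_def)
  define H where "H = {x\<in>B. \<exists>n>0. homog n x}"
  define Dec where "Dec = (\<lambda>(x, y). x * y) ` (H \<times> H)"
  have DecH: "Dec \<subseteq> H"
    by (auto simp: Dec_def H_def Bmult) (metis homog_mult add_gr_0)
  \<comment> \<open>A basis of the positive part that extends a basis of the decomposable elements; the
    generators are the elements added in the extension.\<close>
  obtain E0 where E0: "E0 \<subseteq> Dec" "ncpoly.independent E0" "Dec \<subseteq> ncpoly.span E0"
    using ncpoly.maximal_independent_subset by blast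
  obtain E where E: "E0 \<subseteq> E" "E \<subseteq> H" "ncpoly.independent E" "H \<subseteq> ncpoly.span E"
    using ncpoly.maximal_independent_subset_extend[of E0 H] E0 DecH by blast
  define X where "X = E - E0"
  have XH: "X \<subseteq> H" using E(2) by (auto simp: X_def)
  have HB: "H \<subseteq> B" by (auto simp: H_def)
  have "\<forall>x\<in>H. \<exists>n. n > 0 \<and> homog n x" by (auto simp: H_def)
  from bchoice[OF this] obtain len where len: "\<And>x. x \<in> H \<Longrightarrow> len x > 0 \<and> homog (len x) x"
    by blast
  \<comment> \<open>In a minimal dependent set the elements other than \<open>t\<close> are independent, so that saturation
    applies to the expression of \<open>t\<close> by them.\<close>
  have indep: "right_indep (free_alg Y) S" if "finite S" "S \<subseteq> X" for S
    using that
  proof (induction S rule: finite_psubset_induct)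
    case (psubset S)
    show ?case
    proof (rule ccontr)
      assume dep: "\<not> right_indep (free_alg Y) S"
      obtain t g where t: "t \<in> S" and g: "\<And>s. s \<in> S \<Longrightarrow> g s \<in> free_alg Y"
        "\<And>s. s \<in> S \<Longrightarrow> \<exists>n. homog n (g s)" and sum: "t = (\<Sum>s\<in>S - {t}. s * g s)"
        using right_dependent_homogeneous[OF psubset.hyps dep, of len] len psubset.prems XH
        by blast
      have tB: "(\<Sum>s\<in>S - {t}. s * g s) \<in> B" using sum t psubset.prems XH HB by auto
      have gB: "\<forall>s\<in>S - {t}. g s \<in> B"
      proof (rule sat)
        show "right_indep (free_alg Y) (S - {t})"
          using t psubset.prems by (intro psubset.IH) auto
      qed (use psubset.hyps psubset.prems XH HB g tB in auto)
      have "s * g s \<in> ncpoly.span (E - {t})" if s: "s \<in> S - {t}" for s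
      proof -
        from s g(2) obtain n where n: "homog n (g s)" by blast
        show ?thesis
        proof (cases "n = 0")
          case True
          with n have "s * g s = scale (Poly_Mapping.lookup (g s) []) s"
            by (metis homog_0 mult.right_neutral scale_mult_right)
          moreover have "s \<in> E - {t}" using s psubset.prems by (auto simp: X_def)
          ultimately show ?thesis by (simp add: ncpoly.span_scale ncpoly.span_base)
        next
          case False
          with n gB s have "g s \<in> H" by (auto simp: H_def)
          then have "s * g s \<in> Dec" using s psubset.prems XH by (force simp: Dec_def)
          also have "Dec \<subseteq> ncpoly.span (E - {t})"
            using E0(3) ncpoly.span_mono[of E0 "E - {t}"] E(1) t psubset.prems
            by (auto simp: X_def)
          finally show ?thesis .
        qed
      qed
      then have "t \<in> ncpoly.span (E - {t})"
        by (subst sum) (auto intro: ncpoly.span_sum)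
      with E(3) t psubset.prems show False by (auto simp: ncpoly.dependent_def X_def)
    qed
  qed
  define A where "A = eval_words ` free_alg X"
  have Asub: "ncpoly.subspace A"
  proof (rule ncpoly.subspaceI)
    show "0 \<in> A" unfolding A_def by (rule image_eqI[of _ _ 0]) (simp_all add: free_alg_def)
    show "x + y \<in> A" if "x \<in> A" "y \<in> A" for x y
      using that ncpoly.subspace_add[OF subspace_free_alg, of _ X] unfolding A_def
      by (force simp flip: eval_words_add)
    show "scale c x \<in> A" if "x \<in> A" for c x
      using that ncpoly.subspace_scale[OF subspace_free_alg, of _ X] unfolding A_def
      by (force simp flip: eval_words_scale)
  qed
  have Amult: "x * y \<in> A" if "x \<in> A" "y \<in> A" for x y
    using that free_alg_mult[of _ X] unfolding A_def by (force simp flip: eval_words_mult)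
  have A1: "1 \<in> A" unfolding A_def
    by (rule image_eqI[of _ _ 1]) (simp_all add: one_in_free_alg)
  have XA: "X \<subseteq> A"
  proof
    fix x assume "x \<in> X"
    then show "x \<in> A" unfolding A_def
      by (intro image_eqI[of _ _ "word [x]"]) (simp_all add: free_alg_def)
  qed
  have HA: "x \<in> A" if "x \<in> B" "homog n x" for x n
    using that
  proof (induction n arbitrary: x rule: less_induct)
    case (less n)
    show ?case
    proof (cases "n = 0")
      case True
      then have "x = scale (Poly_Mapping.lookup x []) 1" using less.prems by (auto intro: homog_0)
      then show ?thesis using ncpoly.subspace_scale[OF Asub A1] by metis
    next
      case False
      have base: "homog_part n e \<in> A" if e: "e \<in> E" for e
      proof (cases "homog n e \<and> e \<noteq> 0")
        case True
        then have en: "homog_part n e = e" by (simp add: homog_part_homog[of n])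
        show ?thesis
        proof (cases "e \<in> X")
          case True
          with XA en show ?thesis by auto
        next
          case False
          with e E0(1) obtain y z where yz: "e = y * z" "y \<in> H" "z \<in> H"
            by (auto simp: X_def Dec_def)
          have "homog (len y + len z) e" using yz len by (simp add: homog_mult)
          with True have "n = len y + len z" using homog_unique by blast
          then have "y \<in> A" "z \<in> A"
            using less.IH[of "len y" y] less.IH[of "len z" z] len yz(2,3) HB by auto
          then show ?thesis using yz(1) en Amult by simp
        qed
      next
        case False
        with len[of e] e E(2) have "homog_part n e = 0"
          using homog_part_homog[of "len e" e n] by auto
        then show ?thesis using ncpoly.subspace_0[OF Asub] by simp
      qed
      from False less.prems have "x \<in> ncpoly.span E" using E(4) by (auto simp: H_def)
      then have "homog_part n x \<in> A"
      proof (induction rule: ncpoly.span_induct_alt)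
        case base
        show ?case using ncpoly.subspace_0[OF Asub] by simp
      next
        case (step c x y)
        then show ?case
          using base ncpoly.subspace_add[OF Asub] ncpoly.subspace_scale[OF Asub]
          by (simp add: restrict_words_add restrict_words_scale)
      qed
      with less.prems show ?thesis by (simp add: homog_part_homog[of n])
    qed
  qed
  have BA: "B \<subseteq> A"
  proof
    fix x assume "x \<in> B"
    then have "(\<Sum>n\<in>length ` Poly_Mapping.keys x. homog_part n x) \<in> A"
      by (intro ncpoly.subspace_sum[OF Asub] HA) (auto intro: graded homog_homog_part)
    then show "x \<in> A" by (simp flip: ncpoly_eq_sum_homog_part)
  qed
  have AB: "A \<subseteq> B"
    using eval_words_in[OF B] XH HB by (auto simp: A_def)
  have inj: "inj_on eval_words (free_alg X)"
  proof (rule inj_onI)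
    fix p q assume pq: "p \<in> free_alg X" "q \<in> free_alg X" "eval_words p = eval_words q"
    have "p + q = 0"
    proof (rule eval_words_kernel[OF indep])
      show "X \<subseteq> free_alg Y" using XH HB BY by blast
      show "Poly_Mapping.lookup x [] = 0" if "x \<in> X" for x
        using that len[of x] XH by (force simp: homog_def in_keys_iff)
      show "p + q \<in> free_alg X" using pq by (auto intro: ncpoly.subspace_add[OF subspace_free_alg])
      show "eval_words (p + q) = 0" using pq by (simp add: eval_words_add)
    qed
    then show "p = q" using eq_neg_iff_add_eq_0 ncpoly_uminus by metis
  qed
  have "alg_iso (free_alg X) B eval_words"
    unfolding alg_iso_def using inj AB BA
    by (auto simp: bij_betw_def A_def eval_words_add eval_words_mult eval_words_scale)
  then show ?thesis unfolding is_free_algebra_def by blast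
qed


section \<open>Matrix entries of the Steenrod squares\<close>

text \<open>
  On a word the total square acts letter by letter. A word \<open>z\<close> can occur only in the value at \<open>w\<close> of the
  square whose degree is the difference of the letter sums, so the coefficients below, which carry
  no degree, describe all squares at once.
\<close>

definition letter_coeff :: "nat \<Rightarrow> nat \<Rightarrow> bit" where
  "letter_coeff k l = (if 0 < l \<and> l \<le> k then of_nat (l choose (k - l)) else 0)"

fun word_coeff :: "nat list \<Rightarrow> nat list \<Rightarrow> bit" where
  "word_coeff [] [] = 1"
| "word_coeff (k # w) (l # z) = letter_coeff k l * word_coeff w z"
| "word_coeff _ _ = 0"

lemma bit_mult_eq_1_iff [simp]: "a * b = 1 \<longleftrightarrow> a = 1 \<and> b = 1" for a b :: bit
  by (cases a) simp_all

lemma word_coeff_nonzeroD: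
  "word_coeff w z = 1 \<Longrightarrow> length z = length w \<and> sum_list z \<le> sum_list w \<and> set z \<subseteq> {1..}
    \<and> z \<in> listset (map atMost w)"
  by (induction w z rule: word_coeff.induct) (auto simp: letter_coeff_def set_Cons_def split: if_splits)

lemma lookup_Sq_word:
  "Poly_Mapping.lookup (Sq_word n w) z = (if sum_list z + n = sum_list w then word_coeff w z else 0)"
proof (induction w arbitrary: n z)
  case Nil
  then show ?case by (cases z) (auto simp: one_ncpoly lookup_single)
next
  case (Cons k w)
  show ?case
  proof (cases z)
    case Nil
    have "Poly_Mapping.lookup (Sq_gen i k * q) [] = 0" for i q
      by (simp add: Sq_gen_def gen_def scale_mult_left lookup_letter_mult)
    then show ?thesis by (simp add: Nil lookup_sum)
  next
    case (Cons l u)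
    have "Poly_Mapping.lookup (Sq_word n (k # w)) z
        = (\<Sum>i\<le>n. if 0 < l \<and> l \<le> k \<and> i = k - l
             then letter_coeff k l * Poly_Mapping.lookup (Sq_word (n - i) w) u else 0)"
      unfolding Sq_word.simps lookup_sum
      by (intro sum.cong)
        (auto simp: Sq_gen_def gen_def scale_mult_left lookup_letter_mult letter_coeff_def Cons)
    also have "\<dots> = (if k - l \<le> n
        then letter_coeff k l * Poly_Mapping.lookup (Sq_word (n - (k - l)) w) u else 0)"
      by (cases "0 < l \<and> l \<le> k") (auto simp: letter_coeff_def)
    also have "\<dots> = (if sum_list z + n = sum_list (k # w) then word_coeff (k # w) z else 0)"
      using word_coeff_nonzeroD[of w u]
      by (cases "word_coeff w u"; cases "0 < l \<and> l \<le> k")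
        (auto simp: Cons Cons.IH letter_coeff_def)
    finally show ?thesis .
  qed
qed

lemma lookup_Sq_nonzeroE:
  assumes "Poly_Mapping.lookup (Sq n x) z = 1"
  obtains w where "w \<in> Poly_Mapping.keys x" "word_coeff w z = 1" "sum_list z + n = sum_list w"
proof -
  have "(\<Sum>w\<in>Poly_Mapping.keys x.
      Poly_Mapping.lookup (scale (Poly_Mapping.lookup x w) (Sq_word n w)) z) \<noteq> 0"
    using assms by (simp add: Sq_def lookup_sum)
  then obtain w where "w \<in> Poly_Mapping.keys x"
    "Poly_Mapping.lookup (scale (Poly_Mapping.lookup x w) (Sq_word n w)) z \<noteq> 0"
    by (rule sum.not_neutral_contains_not_neutral)
  then show ?thesis using that by (auto simp: lookup_Sq_word split: if_splits)
qed

lemma subspace_Gamma: "ncpoly.subspace Gamma"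
  by (simp add: Gamma_def subspace_free_alg)

lemma Sq_in_Gamma: "Sq n x \<in> Gamma"
  unfolding Gamma_def free_alg_def mem_Collect_eq
proof
  fix z assume "z \<in> Poly_Mapping.keys (Sq n x)"
  then have "Poly_Mapping.lookup (Sq n x) z = 1" by (simp add: in_keys_iff)
  then obtain w where "word_coeff w z = 1" by (rule lookup_Sq_nonzeroE)
  with word_coeff_nonzeroD show "set z \<subseteq> {1..}" by blast
qed

text \<open>
  Every square is compatible with the bigrading, by length and letter sum: the predicates \<open>P\<close> and \<open>Q\<close>
  single out corresponding components of source and target.
\<close>

lemma Sq_restrict_words:
  assumes "\<And>w z. word_coeff w z = 1 \<Longrightarrow> sum_list z + n = sum_list w \<Longrightarrow> P w \<longleftrightarrow> Q z"
  shows "Sq n (restrict_words P x) = restrict_words Q (Sq n x)"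
proof (induction x rule: ncpoly_induct)
  case zero
  show ?case by simp
next
  case (add w x)
  have "restrict_words Q (Sq_word n w) = (if P w then Sq_word n w else 0)"
  proof (rule poly_mapping_eqI)
    fix z
    show "Poly_Mapping.lookup (restrict_words Q (Sq_word n w)) z
        = Poly_Mapping.lookup (if P w then Sq_word n w else 0) z"
      using assms[of w z] by (cases "word_coeff w z") (auto simp: lookup_Sq_word)
  qed
  moreover have "restrict_words P (word w) = (if P w then word w else 0)"
    by (auto intro: restrict_words_id restrict_words_none)
  ultimately show ?case
    using add by (simp add: restrict_words_add Sq_add Sq_single)
qed

section \<open>The Bullett--Macdonald identity\<close>

text \<open>
  The matrix entries of \<open>P(v) = \<Sum>\<^sub>n v\<^sup>n Sq\<^sup>n\<close>. The parameter is taken from \<open>F\<^sub>2[t]\<close>, which is where the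
  identity is going to be evaluated.
\<close>

definition word_series :: "bit poly \<Rightarrow> nat list \<Rightarrow> nat list \<Rightarrow> bit poly" where
  "word_series v w z = smult (word_coeff w z) (v ^ (sum_list w - sum_list z))"

lemma word_series_Cons:
  "word_series v (k # w) (l # z) = word_series v [k] [l] * word_series v w z"
  using word_coeff_nonzeroD[of w z]
  by (cases "word_coeff w z"; cases "l \<le> k")
    (auto simp: word_series_def letter_coeff_def mult.commute simp flip: power_add)

text \<open>
  The matrix of \<open>P(v)\<close> followed by \<open>P(u)\<close>. Intermediate words have letters bounded by those of \<open>w\<close>,
  because squares lower letters.
\<close>

definition composite :: "bit poly \<Rightarrow> bit poly \<Rightarrow> nat list \<Rightarrow> nat list \<Rightarrow> bit poly" where
  "composite v u w z = (\<Sum>y\<in>listset (map atMost w). word_series v w y * word_series u y z)"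

lemma finite_words_below: "finite (listset (map atMost (w :: nat list)))"
proof (induction w)
  case (Cons k w)
  have "set_Cons {..k} (listset (map atMost w)) = (\<lambda>(a, y). a # y) ` ({..k} \<times> listset (map atMost w))"
    by (auto simp: set_Cons_def)
  with Cons show ?case by simp
qed simp

lemma sum_words_below_Cons:
  "(\<Sum>y\<in>listset (map atMost (k # w)). f y)
    = (\<Sum>a\<le>k. \<Sum>y\<in>listset (map atMost w). f (a # y))" for k :: nat
proof -
  have "listset (map atMost (k # w)) = (\<lambda>(a, y). a # y) ` ({..k} \<times> listset (map atMost w))"
    by (auto simp: set_Cons_def)
  moreover have "inj_on (\<lambda>(a, y). a # y) ({..k} \<times> listset (map atMost w))"
    by (auto simp: inj_on_def)
  ultimately show ?thesis
    by (simp add: sum.reindex sum.cartesian_product case_prod_unfold)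
qed

lemma composite_letter:
  "composite v u [k] [l] = (\<Sum>a\<le>k. word_series v [k] [a] * word_series u [a] [l])"
  unfolding composite_def sum_words_below_Cons by simp

text \<open>
  By distributivity the product of two letterwise operators is again letterwise. This replaces the
  Cartan formula for composites and reduces every identity between them to single letters.
\<close>

lemma composite_Cons:
  "composite v u (k # w) (l # z) = composite v u [k] [l] * composite v u w z"
proof -
  have "composite v u (k # w) (l # z) = (\<Sum>a\<le>k. \<Sum>y\<in>listset (map atMost w).
      (word_series v [k] [a] * word_series u [a] [l]) * (word_series v w y * word_series u y z))"
    unfolding composite_def sum_words_below_Cons
      word_series_Cons[of _ k w] word_series_Cons[of _ _ _ l z]
    by (simp only: mult_ac)
  also have "\<dots> = composite v u [k] [l] * composite v u w z"
    unfolding composite_letter sum_product[symmetric] by (simp only: composite_def)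
  finally show ?thesis .
qed

lemma composite_length: "length z \<noteq> length w \<Longrightarrow> composite v u w z = 0"
  unfolding composite_def
  using word_coeff_nonzeroD by (intro sum.neutral ballI) (fastforce simp: word_series_def)

lemma coeff_linear_power: "coeff ([:1, v:] ^ m) i = of_nat (m choose i) * v ^ i"
  for v :: "'a :: comm_ring_1"
proof (cases "i \<le> m")
  case True
  then show ?thesis by (simp add: coeff_linear_poly_power)
next
  case False
  have "degree ([:1, v:] ^ m) \<le> degree [:1, v:] * m" by (rule degree_power_le)
  also have "degree [:1, v:] * m \<le> m" by simp
  finally show ?thesis using False by (simp add: coeff_eq_0 binomial_eq_0)
qed

text \<open>
  Dually, the total square with parameter \<open>v\<close> is the substitution \<open>x \<mapsto> x + v x\<^sup>2\<close>, so on the power \<open>x^l\<close>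
  the composite becomes the \<open>l\<close>-th power of \<open>(x + v x\<^sup>2) + u (x + v x\<^sup>2)\<^sup>2\<close>. The polynomial in the
  statement is this expression divided by \<open>x\<close>.
\<close>

lemma composite_letter_eq_coeff:
  assumes "0 < l" "l \<le> k"
  shows "composite v u [k] [l] = coeff (([:1, v:] * (1 + [:0, u:] * [:1, v:])) ^ l) (k - l)"
proof -
  define r where "r = k - l"
  have k: "k = l + r" using assms by (simp add: r_def)
  define T where "T j = of_nat ((l + j choose (r - j)) * (l choose j)) * (v ^ (r - j) * u ^ j)" for j
  have "composite v u [k] [l] = (\<Sum>a\<in>{l..l + r}. word_series v [k] [a] * word_series u [a] [l])"
    unfolding composite_letter k
    by (rule sum.mono_neutral_right) (auto simp: word_series_def letter_coeff_def)
  also have "\<dots> = (\<Sum>j\<le>r. word_series v [k] [l + j] * word_series u [l + j] [l])"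
    by (rule sum.reindex_bij_witness[where i = "\<lambda>j. l + j" and j = "\<lambda>a. a - l"]) auto
  also have "\<dots> = (\<Sum>j\<le>r. T j)"
    using assms(1) by (intro sum.cong) (auto simp: word_series_def letter_coeff_def k T_def of_nat_poly mult_ac)
  \<comment> \<open>The summation bound \<open>r\<close> is exchanged for \<open>l\<close>, the one of the binomial theorem: the binomial
    coefficient vanishes for \<open>j > l\<close>, the coefficient of the polynomial for \<open>j > r\<close>.\<close>
  also have "\<dots> = (\<Sum>j\<le>l + r. if j \<le> r then T j else 0)"
    by (rule sum.mono_neutral_cong_left) auto
  also have "\<dots> = (\<Sum>j\<le>l. if j \<le> r then T j else 0)"
    by (rule sum.mono_neutral_right) (auto simp: T_def binomial_eq_0)
  also have "\<dots> = (\<Sum>j\<le>l. coeff (monom (of_nat (l choose j) * u ^ j) j * [:1, v:] ^ (l + j)) r)"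
    by (intro sum.cong)
      (simp_all add: coeff_monom_mult coeff_linear_power, simp add: T_def mult_ac)
  also have "\<dots> = coeff (([:1, v:] * (1 + [:0, u:] * [:1, v:])) ^ l) r"
  proof -
    have "([:1, v:] * (1 + [:0, u:] * [:1, v:])) ^ l = [:1, v:] ^ l * (monom u 1 * [:1, v:] + 1) ^ l"
    proof -
      have "monom u 1 = [:0, u:]" by (simp add: monom_altdef)
      then show ?thesis by (simp only: power_mult_distrib add.commute)
    qed
    also have "\<dots> = (\<Sum>j\<le>l. monom (of_nat (l choose j) * u ^ j) j * [:1, v:] ^ (l + j))"
      unfolding binomial_ring sum_distrib_left
    proof (rule sum.cong[OF refl])
      fix j
      have "monom (of_nat (l choose j) * u ^ j) j = of_nat (l choose j) * monom u 1 ^ j"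
        by (simp add: monom_power of_nat_monom mult_monom)
      then show "[:1, v:] ^ l * (of_nat (l choose j) * (monom u 1 * [:1, v:]) ^ j * 1 ^ (l - j))
          = monom (of_nat (l choose j) * u ^ j) j * [:1, v:] ^ (l + j)"
        by (simp only: power_mult_distrib power_add power_one mult_1_left mult_1_right mult_ac)
    qed
    finally show ?thesis by (simp add: coeff_sum)
  qed
  finally show ?thesis by (simp add: r_def)
qed

lemma bit_poly_two_eq_0 [simp]: "(2 :: bit poly) = 0"
  by (simp add: numeral_poly)

lemma bit_poly_add_self [simp]: "p + p = (0 :: bit poly)"
  by (simp flip: mult_2)

text \<open>
  The quadratic term \<open>2 u v\<close> vanishes in characteristic two. That leaves \<open>u + v\<close> and \<open>u v\<^sup>2\<close>, both of
  which are symmetric in \<open>s, t\<close> for \<open>v = s\<^sup>2 + s t\<close> and \<open>u = t\<^sup>2\<close>.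
\<close>

lemma letter_polynomial:
  "[:1, v:] * (1 + [:0, u:] * [:1, v:]) = [:1, u + v, 0, u * v\<^sup>2:]" for u v :: "bit poly"
  by (simp add: power2_eq_square one_pCons[where 'a = "bit poly"] mult_ac add_ac)

lemma composite_cong:
  assumes "u + v = u' + v'" "u * v\<^sup>2 = u' * v'\<^sup>2"
  shows "composite v u w z = composite v' u' w z"
proof (cases "length z = length w")
  case True
  have letter: "composite v u [k] [l] = composite v' u' [k] [l]" for k l
  proof (cases "0 < l \<and> l \<le> k")
    case True
    then show ?thesis using assms by (simp only: composite_letter_eq_coeff letter_polynomial)
  next
    case False
    then have "composite v u [k] [l] = 0" for v u
      unfolding composite_letter by (intro sum.neutral) (auto simp: word_series_def letter_coeff_def)
    then show ?thesis by simp
  qed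
  from True show ?thesis
  proof (induction z w rule: list_induct2)
    case Nil
    show ?case by (simp add: composite_def word_series_def)
  next
    case (Cons l z k w)
    then show ?case using letter by (simp add: composite_Cons[of _ _ k w])
  qed
qed (simp add: composite_length)

text \<open>
  The coefficient of \<open>z\<close> in the part of \<open>(x) P(v) P(u)\<close> that lowers the degree by \<open>n\<close>.
\<close>

definition Sq_composites :: "bit poly \<Rightarrow> bit poly \<Rightarrow> nat \<Rightarrow> nat ncpoly \<Rightarrow> nat list \<Rightarrow> bit poly" where
  "Sq_composites v u n x z
    = (\<Sum>a\<le>n. smult (Poly_Mapping.lookup (Sq (n - a) (Sq a x)) z) (v ^ a * u ^ (n - a)))"

lemma Sq_composites_word:
  "Sq_composites v u n (word w) z = (if sum_list z + n = sum_list w then composite v u w z else 0)"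
proof -
  let ?Y = "listset (map atMost w)"
  have keys_sub: "Poly_Mapping.keys (Sq_word a w) \<subseteq> ?Y" for a
    using word_coeff_nonzeroD by (auto simp: in_keys_iff lookup_Sq_word split: if_splits)
  have "Sq_composites v u n (word w) z
      = (\<Sum>a\<le>n. \<Sum>y\<in>?Y.
            smult (Poly_Mapping.lookup (Sq_word a w) y * Poly_Mapping.lookup (Sq_word (n - a) y) z)
              (v ^ a * u ^ (n - a)))"
    unfolding Sq_composites_def
    by (simp add: Sq_single Sq_superset[OF finite_words_below keys_sub] lookup_sum smult_sum)
  also have "\<dots> = (\<Sum>y\<in>?Y. \<Sum>a\<le>n.
            smult (Poly_Mapping.lookup (Sq_word a w) y * Poly_Mapping.lookup (Sq_word (n - a) y) z)
              (v ^ a * u ^ (n - a)))"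
    by (rule sum.swap)
  also have "\<dots> = (\<Sum>y\<in>?Y. if sum_list z + n = sum_list w
      then word_series v w y * word_series u y z else 0)"
  proof (rule sum.cong[OF refl])
    fix y
    show "(\<Sum>a\<le>n.
            smult (Poly_Mapping.lookup (Sq_word a w) y * Poly_Mapping.lookup (Sq_word (n - a) y) z)
              (v ^ a * u ^ (n - a)))
        = (if sum_list z + n = sum_list w then word_series v w y * word_series u y z else 0)" (is "?L = _")
    proof (cases "word_coeff w y = 1 \<and> word_coeff y z = 1")
      case True
      then have le: "sum_list z \<le> sum_list y" "sum_list y \<le> sum_list w"
        using word_coeff_nonzeroD by blast+
      have "?L = (\<Sum>a\<le>n. if a = sum_list w - sum_list y \<and> sum_list z + n = sum_list w
           then v ^ a * u ^ (n - a) else 0)"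
        using le by (intro sum.cong) (auto simp: lookup_Sq_word True)
      also have "\<dots> = (if sum_list z + n = sum_list w then word_series v w y * word_series u y z else 0)"
      proof (cases "sum_list z + n = sum_list w")
        case deg: True
        then have "n - (sum_list w - sum_list y) = sum_list y - sum_list z" "sum_list w - sum_list y \<le> n"
          using le by auto
        with deg True show ?thesis by (simp add: word_series_def)
      qed simp
      finally show ?thesis .
    next
      case False
      then show ?thesis by (auto simp: lookup_Sq_word word_series_def intro!: sum.neutral)
    qed
  qed
  finally show ?thesis by (simp add: composite_def)
qed

lemma Bullett_Macdonald:
  assumes "u + v = u' + v'" "u * v\<^sup>2 = u' * v'\<^sup>2"
  shows "Sq_composites v u n x z = Sq_composites v' u' n x z"
proof (induction x rule: ncpoly_induct)
  case zero
  show ?case by (simp add: Sq_composites_def)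
next
  case (add w x)
  have "Sq_composites v u n (x + y) z = Sq_composites v u n x z + Sq_composites v u n y z" for v u x y
    by (simp add: Sq_composites_def Sq_add lookup_add smult_add_left sum.distrib)
  with add show ?case by (simp add: Sq_composites_word composite_cong[OF assms])
qed

section \<open>Squares whose degree is not a power of two\<close>

text \<open>
  Write \<open>n = 2^e + r\<close> with \<open>r < 2^e\<close>. Modulo two, \<open>(1 + t)^n = (1 + t^(2^e)) (1 + t)^r\<close>, and the second
  factor has degree below \<open>2^e\<close>.
\<close>

lemma odd_binomial_power2:
  assumes "2 ^ e < n" "n < 2 ^ (e + 1)"
  shows "of_nat (n choose 2 ^ e) = (1 :: bit)"
proof -
  define r where "r = n - 2 ^ e"
  have r: "n = 2 ^ e + r" "r < 2 ^ e" using assms by (auto simp: r_def)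
  have frob: "[:1, 1 :: bit:] ^ 2 ^ e = 1 + monom 1 (2 ^ e)"
  proof (induction e)
    case 0
    show ?case by (simp add: monom_altdef one_pCons)
  next
    case (Suc e)
    have "[:1, 1 :: bit:] ^ 2 ^ Suc e = ([:1, 1:] ^ 2 ^ e) ^ 2"
      by (simp add: mult.commute flip: power_mult)
    also have "\<dots> = 1 + monom 1 (2 ^ Suc e) + (monom 1 (2 ^ e) + monom 1 (2 ^ e))"
      unfolding Suc.IH power2_eq_square by (simp add: algebra_simps mult_monom mult_2)
    finally show ?case by simp
  qed
  have "of_nat (n choose 2 ^ e) = coeff ([:1, 1 :: bit:] ^ n) (2 ^ e)"
    by (simp add: coeff_linear_power)
  also have "[:1, 1 :: bit:] ^ n = [:1, 1:] ^ r + monom 1 (2 ^ e) * [:1, 1:] ^ r"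
    by (simp add: r(1) power_add frob distrib_right)
  also have "coeff \<dots> (2 ^ e) = 1"
    using r(2) by (simp add: coeff_linear_power coeff_monom_mult binomial_eq_0)
  finally show ?thesis .
qed

text \<open>
  If all smaller squares kill \<open>x\<close>, only the two outermost composites survive in degree \<open>n\<close>, and the
  Bullett--Macdonald identity reads \<open>(u^n + v^n) y = (u'^n + v'^n) y\<close> with \<open>y = Sq\<^sup>n x\<close>. For \<open>s = 1\<close>
  the parameters are \<open>v = 1 + t\<close>, \<open>u = t\<^sup>2\<close> on the left and \<open>v' = t + t\<^sup>2\<close>, \<open>u' = 1\<close> on the right. The
  coefficients of \<open>t^(2^e)\<close> are \<open>n choose 2^e\<close>, which is odd, and \<open>0\<close>, so \<open>y = 0\<close>.
\<close>

lemma Sq_eq_0_if_lower_eq_0: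
  assumes x: "x \<in> Gamma" and n: "2 ^ e < n" "n < 2 ^ (e + 1)"
    and lower: "\<And>a. 0 < a \<Longrightarrow> a < n \<Longrightarrow> Sq a x = 0"
  shows "Sq n x = 0"
proof (rule ccontr)
  assume "Sq n x \<noteq> 0"
  then obtain z where "z \<in> Poly_Mapping.keys (Sq n x)"
    by fastforce
  then have z: "Poly_Mapping.lookup (Sq n x) z = 1" by (simp add: in_keys_iff)
  have n0: "n > 0" using n by simp
  have comps: "Sq_composites v u n x z = u ^ n + v ^ n" for v u
  proof -
    have "Sq_composites v u n x z
        = (\<Sum>a\<in>{0, n}. smult (Poly_Mapping.lookup (Sq (n - a) (Sq a x)) z) (v ^ a * u ^ (n - a)))"
      unfolding Sq_composites_def using lower by (intro sum.mono_neutral_right) auto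
    then show ?thesis using n0 by (simp add: z Sq_0 x Sq_in_Gamma)
  qed
  define t :: "bit poly" where "t = monom 1 1"
  have lin: "[:1, 1:] = 1 + t" by (simp add: t_def monom_altdef one_pCons)
  have tn: "t ^ m = monom 1 m" for m by (simp add: t_def monom_power)
  have "(t\<^sup>2) ^ n + (1 + t) ^ n = 1 ^ n + (t * (1 + t)) ^ n"
    unfolding comps[symmetric]
  proof (rule Bullett_Macdonald)
    show "t\<^sup>2 + (1 + t) = 1 + t * (1 + t)" by (simp add: algebra_simps power2_eq_square)
    show "t\<^sup>2 * (1 + t)\<^sup>2 = 1 * (t * (1 + t))\<^sup>2" by (simp add: power_mult_distrib)
  qed
  then have "coeff ((t\<^sup>2) ^ n + (1 + t) ^ n) (2 ^ e) = coeff (1 ^ n + (t * (1 + t)) ^ n) (2 ^ e)"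
    by simp
  moreover have "coeff ((t\<^sup>2) ^ n) (2 ^ e) = 0"
    using n by (simp add: tn[of "2 * n"] flip: power_mult)
  moreover have "coeff ((1 + t) ^ n) (2 ^ e) = 1"
    using odd_binomial_power2[OF n] by (simp add: coeff_linear_power flip: lin)
  moreover have "coeff ((t * (1 + t)) ^ n) (2 ^ e) = 0"
    using n by (simp add: power_mult_distrib tn coeff_monom_mult)
  ultimately show False by simp
qed

lemma Sq_eq_0_if_powers_eq_0:
  assumes x: "x \<in> Gamma" and powers: "\<And>i. i \<le> k \<Longrightarrow> Sq (2 ^ i) x = 0"
  shows "0 < n \<Longrightarrow> n < 2 ^ (k + 1) \<Longrightarrow> Sq n x = 0"
proof (induction n rule: less_induct)
  case (less n)
  obtain e where e: "2 ^ e \<le> n" "n < 2 ^ (e + 1)"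
    using ex_power_ivl1[of 2 n] less.prems by auto
  show ?case
  proof (cases "n = 2 ^ e")
    case True
    with less.prems have "2 ^ e < (2 :: nat) ^ (k + 1)" by simp
    then have "e \<le> k" using power_less_imp_less_exp[of "2 :: nat" e "k + 1"] by simp
    with powers True show ?thesis by simp
  next
    case False
    show ?thesis
    proof (rule Sq_eq_0_if_lower_eq_0[OF x])
      show "2 ^ e < n" "n < 2 ^ (e + 1)" using e False by simp_all
      show "Sq a x = 0" if "0 < a" "a < n" for a
        using less.IH[OF that(2,1)] less.prems that(2) by simp
    qed
  qed
qed

section \<open>The invariants form a free subalgebra\<close>

text \<open>
  The squares respect the bigrading, so the components of an element killed by them are killed as
  well; hence the span of the homogeneous kernels is the whole kernel.
\<close>

lemma Delta_eq: "Delta k = {x \<in> Gamma. \<forall>n. 0 < n \<longrightarrow> n < 2 ^ (k + 1) \<longrightarrow> Sq n x = 0}" (is "_ = ?R")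
proof
  have "ncpoly.subspace ?R"
    using subspace_Gamma by (auto simp: ncpoly.subspace_def Sq_add Sq_scale)
  moreover have "Delta_comp k s d \<subseteq> ?R" for s d
    using Sq_eq_0_if_powers_eq_0[of _ k] by (auto simp: Delta_comp_def Gamma_comp_def)
  ultimately show "Delta k \<subseteq> ?R"
    unfolding Delta_def by (intro ncpoly.span_minimal) auto
next
  show "?R \<subseteq> Delta k"
  proof
    fix x assume x: "x \<in> ?R"
    define bideg :: "nat list \<Rightarrow> nat \<times> nat" where "bideg w = (length w, sum_list w)" for w
    have "restrict_words (\<lambda>w. bideg w = b) x \<in> Delta k" for b
    proof -
      have "Sq (2 ^ i) (restrict_words (\<lambda>w. bideg w = b) x) = 0" if "i \<le> k" for i
      proof -
        have less: "2 ^ i < (2 :: nat) ^ (k + 1)"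
          using that by (intro power_strict_increasing) auto
        have "Sq (2 ^ i) (restrict_words (\<lambda>w. bideg w = b) x)
            = restrict_words (\<lambda>z. (length z, sum_list z + 2 ^ i) = b) (Sq (2 ^ i) x)"
          by (rule Sq_restrict_words) (auto simp: bideg_def dest: word_coeff_nonzeroD)
        also have "Sq (2 ^ i) x = 0" using x less by simp
        finally show ?thesis by simp
      qed
      moreover have "restrict_words (\<lambda>w. bideg w = b) x \<in> Gamma"
        using x by (auto simp: Gamma_def intro: free_alg_restrict_words)
      ultimately have "restrict_words (\<lambda>w. bideg w = b) x \<in> Delta_comp k (fst b) (snd b)"
        by (auto simp: Delta_comp_def Gamma_comp_def keys_restrict_words bideg_def)
      then show ?thesis unfolding Delta_def by (intro ncpoly.span_base) auto
    qed
    then have "(\<Sum>b\<in>bideg ` Poly_Mapping.keys x. restrict_words (\<lambda>w. bideg w = b) x) \<in> Delta k"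
      unfolding Delta_def by (intro ncpoly.span_sum) auto
    also have "(\<Sum>b\<in>bideg ` Poly_Mapping.keys x. restrict_words (\<lambda>w. bideg w = b) x) = x"
      by (rule poly_mapping_eqI) (auto simp: lookup_sum in_keys_iff)
    finally show "x \<in> Delta k" .
  qed
qed

text \<open>
  The Cartan formula collapses to its term with \<open>Sq\<^sup>0 b = b\<close>: the squares below \<open>2^(k+1)\<close> are linear over
  left multiplication by invariants.
\<close>

lemma Sq_mult_invariant:
  assumes "b \<in> Delta k" "n < 2 ^ (k + 1)"
  shows "Sq n (b * f) = b * Sq n f"
proof -
  have "Sq n (b * f) = (\<Sum>i\<le>n. if i = 0 then b * Sq n f else 0)"
    unfolding Sq_cartan using assms by (intro sum.cong) (auto simp: Delta_eq Sq_0)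
  then show ?thesis by simp
qed

lemma Sq_sum: "Sq n (\<Sum>i\<in>I. f i) = (\<Sum>i\<in>I. Sq n (f i))"
  by (induction I rule: infinite_finite_induct) (simp_all add: Sq_add)

lemma subalgebra_Delta: "subalgebra (Delta k) Gamma"
proof -
  have "ncpoly.subspace (Delta k)" by (simp add: Delta_def)
  moreover have "1 \<in> Delta k"
    using one_in_free_alg by (auto simp: Delta_eq Gamma_def Sq_one)
  moreover have "x * y \<in> Delta k" if "x \<in> Delta k" "y \<in> Delta k" for x y
  proof -
    have "x * y \<in> Gamma" using that free_alg_mult by (auto simp: Delta_eq Gamma_def)
    then show ?thesis
      using that Sq_mult_invariant[OF that(1), of _ y] by (simp add: Delta_eq)
  qed
  ultimately show ?thesis by (auto simp: subalgebra_def) (simp add: Delta_eq)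
qed

text \<open>
  Saturation: if \<open>\<Sum> s g\<^sub>s\<close> is invariant with invariant and right independent \<open>s\<close>, then
  \<open>\<Sum> s Sq\<^sup>n g\<^sub>s = 0\<close>, so all \<open>Sq\<^sup>n g\<^sub>s\<close> vanish.
\<close>

lemma is_free_algebra_Delta: "is_free_algebra (Delta k)"
proof (rule free_if_right_saturated[where Y = "{1..}"])
  show "subalgebra (Delta k) (free_alg {1..})" using subalgebra_Delta by (simp add: Gamma_def)
next
  fix x :: "nat ncpoly" and m
  assume x: "x \<in> Delta k"
  have "Sq n (homog_part m x) = homog_part m (Sq n x)" for n
    by (rule Sq_restrict_words) (auto dest: word_coeff_nonzeroD)
  then show "homog_part m x \<in> Delta k"
    using x by (auto simp: Delta_eq Gamma_def free_alg_restrict_words)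
next
  fix S and g :: "nat ncpoly \<Rightarrow> nat ncpoly"
  assume S: "S \<subseteq> Delta k" and indep: "right_indep (free_alg {1..}) S"
    and g: "\<And>s. s \<in> S \<Longrightarrow> g s \<in> free_alg {1..}" and sum: "(\<Sum>s\<in>S. s * g s) \<in> Delta k"
  have "Sq n (g s) = 0" if "s \<in> S" "0 < n" "n < 2 ^ (k + 1)" for s n
  proof -
    have "(\<Sum>s\<in>S. s * Sq n (g s)) = (\<Sum>s\<in>S. Sq n (s * g s))"
      using S that(3) by (intro sum.cong) (auto simp: Sq_mult_invariant)
    also have "\<dots> = Sq n (\<Sum>s\<in>S. s * g s)" by (simp add: Sq_sum)
    also have "\<dots> = 0" using sum that by (simp add: Delta_eq)
    finally show ?thesis
      using indep[unfolded right_indep_def, rule_format, of "\<lambda>s. Sq n (g s)" s] Sq_in_Gamma that(1)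
      by (auto simp: Gamma_def)
  qed
  with g show "\<forall>s\<in>S. g s \<in> Delta k" by (auto simp: Delta_eq Gamma_def)
qed

theorem theorem1:
  fixes k :: nat
  shows "subalgebra (Delta k) Gamma \<and> is_free_algebra (Delta k)"
  using subalgebra_Delta is_free_algebra_Delta by blast

end
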